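(* Let $q\in\mathbb{C}$ with $|q|<1$, let $\alpha,\beta\in\mathbb{C}$ and let $n\ge 0$ be an integer. The homogeneous polynomials $\Phi_n^{(\alpha,\beta)}(x,y|q)$ satisfy the $q$-partial differential equation $$\partial_{q,x}\left\{\Phi_n^{(\alpha,\beta)}(x,y|q)-\beta\,\Phi_n^{(\alpha,\beta)}(x,qy|q)\right\}=\partial_{q,y}\left\{\Phi_n^{(\alpha,\beta)}(x,y|q)-\alpha\,\Phi_n^{(\alpha,\beta)}(qx,y|q)\right\}.$$
   Context: For $a\in\mathbb{C}$: $(a;q)_0=1$, $(a;q)_n=\prod_{i=0}^{n-1}(1-aq^i)$ for $n\ge1$. The $q$-binomial coefficient is ${n\brack k}_q=\frac{(q;q)_n}{(q;q)_k(q;q)_{n-k}}$, and $\Phi_n^{(\alpha,\beta)}(x,y|q)=\sum_{k=0}^n {n\brack k}_q(\alpha;q)_k(\beta;q)_{n-k}x^ky^{n-k}$. The $q$-derivative of a one-variable function is $D_q\{f(x)\}=\frac{f(x)-f(qx)}{x}$ (no factor $1-q$), and $\partial_{q,x}\{f\}$ is the $q$-derivative of $f$ with respect to $x$, the other variables being regarded as constants. *)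

theory Defs
  imports Complex_Main
begin

definition qpoch :: "complex \<Rightarrow> complex \<Rightarrow> nat \<Rightarrow> complex" where
  "qpoch a q n = (\<Prod>i<n. 1 - a * q ^ i)"

(* Meaningful for k \<le> n only; natural-number subtraction truncates otherwise. *)
definition qbinom :: "complex \<Rightarrow> nat \<Rightarrow> nat \<Rightarrow> complex" where
  "qbinom q n k = qpoch q q n / (qpoch q q k * qpoch q q (n - k))"

definition Phi :: "complex \<Rightarrow> nat \<Rightarrow> complex \<Rightarrow> complex \<Rightarrow> complex \<Rightarrow> complex \<Rightarrow> complex" where
  "Phi q n \<alpha> \<beta> x y =
     (\<Sum>k\<le>n. qbinom q n k * qpoch \<alpha> q k * qpoch \<beta> q (n - k) * x ^ k * y ^ (n - k))"

(* The q-derivative without the factor 1 - q. The quotient has no meaning at 0, where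
   HOL would give it the value 0; there the q-derivative is the limit of the quotient,
   as is implicit when the q-derivative of a polynomial is read as a polynomial. *)
definition q_deriv :: "complex \<Rightarrow> (complex \<Rightarrow> complex) \<Rightarrow> complex \<Rightarrow> complex" where
  "q_deriv q f x =
     (if x = 0 then Lim (at 0) (\<lambda>z. (f z - f (q * z)) / z)
      else (f x - f (q * x)) / x)"

definition q_partial_x ::
    "complex \<Rightarrow> (complex \<Rightarrow> complex \<Rightarrow> complex) \<Rightarrow> complex \<Rightarrow> complex \<Rightarrow> complex" where
  "q_partial_x q F x y = q_deriv q (\<lambda>t. F t y) x"

definition q_partial_y ::
    "complex \<Rightarrow> (complex \<Rightarrow> complex \<Rightarrow> complex) \<Rightarrow> complex \<Rightarrow> complex \<Rightarrow> complex" where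
  "q_partial_y q F x y = q_deriv q (\<lambda>t. F x t) y"

end

theory Submission
  imports Defs
begin

text \<open>
  Two relations move the parameters of the polynomials \<open>Phi\<close>. Write
  \<open>\<Phi>\<^sub>n\<^bsup>(\<alpha>,\<beta>)\<^esup>\<close> for \<open>Phi q n \<alpha> \<beta>\<close>. The shift in \<open>y\<close> moves the parameter \<open>\<beta>\<close>, because
  the factor \<open>1 - \<beta> q^j\<close> which it attaches to \<open>y^j\<close> extends the \<open>q\<close>-shifted factorial of \<open>\<beta>\<close>
  by one step (\<open>Phi_shift_y\<close>):
  \<open>\<Phi>\<^sub>n\<^bsup>(\<alpha>,\<beta>)\<^esup>(x, y) - \<beta> \<Phi>\<^sub>n\<^bsup>(\<alpha>,\<beta>)\<^esup>(x, q y) = (1 - \<beta>) \<Phi>\<^sub>n\<^bsup>(\<alpha>,q\<beta>)\<^esup>(x, y)\<close>.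
  The \<open>q\<close>-derivative in \<open>x\<close>, written \<open>D\<^sub>q\<close>, lowers the degree and moves \<open>\<alpha>\<close> (\<open>q_deriv_Phi\<close>):
  \<open>D\<^sub>q \<Phi>\<^sub>n\<^bsup>(\<alpha>,\<beta>)\<^esup> = (1 - q^n) (1 - \<alpha>) \<Phi>\<^sub>n\<^sub>-\<^sub>1\<^bsup>(q\<alpha>,\<beta>)\<^esup>\<close>.
  Together they turn the left-hand side of the equation into
  \<open>(1 - \<alpha>) (1 - \<beta>) (1 - q^n) \<Phi>\<^sub>n\<^sub>-\<^sub>1\<^bsup>(q\<alpha>,q\<beta>)\<^esup>(x, y)\<close>. The right-hand side arises from the left
  by exchanging \<open>(\<alpha>, x)\<close> with \<open>(\<beta>, y)\<close>, and \<open>Phi\<close> is invariant under this exchange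
  (\<open>Phi_swap\<close>), so the right-hand side has the same value.
\<close>

lemma qpoch_Suc: "qpoch a q (Suc n) = qpoch a q n * (1 - a * q ^ n)"
  by (simp add: qpoch_def)

lemma qpoch_Suc_shift: "qpoch a q (Suc n) = (1 - a) * qpoch (q * a) q n"
  by (simp add: qpoch_def prod.lessThan_Suc_shift ac_simps del: prod.lessThan_Suc)

text \<open>
  The denominators of the \<open>q\<close>-binomial coefficients do not vanish, since no positive power of
  \<open>q\<close> equals 1 inside the unit disc.
\<close>

lemma one_minus_power_neq_0:
  fixes q :: complex
  assumes "norm q < 1"
  shows "1 - q ^ Suc i \<noteq> 0"
proof
  assume "1 - q ^ Suc i = 0"
  then have "norm (q ^ Suc i) = 1"
    by simp
  moreover have "norm (q ^ Suc i) < 1"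
    unfolding norm_power using assms by (subst power_less_one_iff) auto
  ultimately show False
    by simp
qed

lemma qpoch_self_neq_0:
  assumes "norm q < 1"
  shows "qpoch q q n \<noteq> 0"
  using one_minus_power_neq_0[OF assms] by (simp add: qpoch_def)

lemma qbinom_swap:
  assumes "k \<le> n"
  shows "qbinom q n (n - k) = qbinom q n k"
  using assms by (simp add: qbinom_def mult.commute)

lemma qbinom_absorption:
  assumes "norm q < 1"
  shows "qbinom q (Suc n) (Suc k) * (1 - q ^ Suc k) = (1 - q ^ Suc n) * qbinom q n k"
  using qpoch_self_neq_0[OF assms] one_minus_power_neq_0[OF assms, of k]
  by (simp add: qbinom_def qpoch_Suc divide_simps)

lemma Phi_swap: "Phi q n \<alpha> \<beta> x y = Phi q n \<beta> \<alpha> y x"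
  unfolding Phi_def
  by (rule sum.reindex_bij_witness[of _ "\<lambda>k. n - k" "\<lambda>k. n - k"])
     (auto simp: qbinom_swap)

lemma Phi_shift_y:
  "Phi q n \<alpha> \<beta> x y - \<beta> * Phi q n \<alpha> \<beta> x (q * y) = (1 - \<beta>) * Phi q n \<alpha> (q * \<beta>) x y"
proof -
  have step: "qpoch \<beta> q j * (1 - \<beta> * q ^ j) = (1 - \<beta>) * qpoch (q * \<beta>) q j" for j
    by (simp flip: qpoch_Suc qpoch_Suc_shift)
  have "Phi q n \<alpha> \<beta> x y - \<beta> * Phi q n \<alpha> \<beta> x (q * y) =
      (\<Sum>k\<le>n. qbinom q n k * qpoch \<alpha> q k * (qpoch \<beta> q (n - k) * (1 - \<beta> * q ^ (n - k)))
               * x ^ k * y ^ (n - k))"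
    by (simp add: Phi_def sum_distrib_left power_mult_distrib algebra_simps flip: sum_subtractf)
  also have "\<dots> = (1 - \<beta>) * Phi q n \<alpha> (q * \<beta>) x y"
    unfolding step by (simp add: Phi_def sum_distrib_left ac_simps)
  finally show ?thesis .
qed

text \<open>
  Away from 0 the difference quotient of a polynomial is again a polynomial. By continuity its
  value at 0 is the limit that defines the \<open>q\<close>-derivative there, so a single formula covers
  all points.
\<close>

lemma q_deriv_polynomial:
  "q_deriv q (\<lambda>t. \<Sum>k\<le>n. c k * t ^ k) x = (\<Sum>k<n. c (Suc k) * (1 - q ^ Suc k) * x ^ k)"
proof -
  let ?f = "\<lambda>t. \<Sum>k\<le>n. c k * t ^ k"
  let ?g = "\<lambda>t. \<Sum>k<n. c (Suc k) * (1 - q ^ Suc k) * t ^ k"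
  have quotient: "(?f z - ?f (q * z)) / z = ?g z" if "z \<noteq> 0" for z
  proof -
    have "?f z - ?f (q * z) = (\<Sum>k\<le>n. c k * (1 - q ^ k) * z ^ k)"
      by (simp add: power_mult_distrib algebra_simps flip: sum_subtractf)
    also have "\<dots> = z * ?g z"
      by (simp add: sum.atMost_shift sum_distrib_left ac_simps)
    finally show ?thesis
      using that by simp
  qed
  have "(?g \<longlongrightarrow> ?g 0) (at 0)"
    by (intro tendsto_intros)
  moreover have "\<forall>\<^sub>F z in at 0. ?g z = (?f z - ?f (q * z)) / z"
    using quotient by (auto simp: eventually_at_topological intro!: exI[of _ UNIV])
  ultimately have "((\<lambda>z. (?f z - ?f (q * z)) / z) \<longlongrightarrow> ?g 0) (at 0)"
    by (rule Lim_transform_eventually)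
  then have "Lim (at 0) (\<lambda>z. (?f z - ?f (q * z)) / z) = ?g 0"
    by (intro tendsto_Lim) auto
  then show ?thesis
    using quotient by (auto simp: q_deriv_def)
qed

text \<open>
  The factor \<open>1 - q^k\<close> produced by differentiating \<open>x^k\<close> is absorbed by the
  \<open>q\<close>-binomial coefficient, and the remaining shift of the index \<open>k\<close> splits the factor
  \<open>1 - \<alpha>\<close> off \<open>(\<alpha>;q)\<^sub>k\<close>. The constant \<open>c\<close> lets the lemma apply directly to the right-hand
  side of \<open>Phi_shift_y\<close>. For \<open>n = 0\<close> the truncated degree \<open>n - 1\<close> is harmless, as
  \<open>1 - q^n\<close> vanishes.
\<close>

lemma q_deriv_Phi:
  assumes "norm q < 1"
  shows "q_deriv q (\<lambda>t. c * Phi q n \<alpha> \<beta> t y) x =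
    c * ((1 - q ^ n) * (1 - \<alpha>) * Phi q (n - 1) (q * \<alpha>) \<beta> x y)"
proof -
  define a where "a k = c * (qbinom q n k * qpoch \<alpha> q k * qpoch \<beta> q (n - k) * y ^ (n - k))" for k
  have "(\<lambda>t. c * Phi q n \<alpha> \<beta> t y) = (\<lambda>t. \<Sum>k\<le>n. a k * t ^ k)"
    by (simp add: Phi_def a_def sum_distrib_left ac_simps)
  then have deriv: "q_deriv q (\<lambda>t. c * Phi q n \<alpha> \<beta> t y) x =
      (\<Sum>k<n. a (Suc k) * (1 - q ^ Suc k) * x ^ k)"
    by (simp only: q_deriv_polynomial)
  show ?thesis
  proof (cases n)
    case 0
    then show ?thesis
      using deriv by simp
  next
    case (Suc m)
    have "a (Suc k) * (1 - q ^ Suc k) * x ^ k =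
        c * ((1 - q ^ n) * (1 - \<alpha>) *
          (qbinom q m k * qpoch (q * \<alpha>) q k * qpoch \<beta> q (m - k) * x ^ k * y ^ (m - k)))" for k
    proof -
      have "a (Suc k) * (1 - q ^ Suc k) * x ^ k =
          c * (qbinom q (Suc m) (Suc k) * (1 - q ^ Suc k)) * qpoch \<alpha> q (Suc k)
            * qpoch \<beta> q (m - k) * x ^ k * y ^ (m - k)"
        by (simp add: a_def Suc)
      then show ?thesis
        unfolding qbinom_absorption[OF assms] qpoch_Suc_shift Suc by (simp only: ac_simps)
    qed
    then show ?thesis
      unfolding deriv
      by (simp only: Suc Phi_def sum_distrib_left lessThan_Suc_atMost diff_Suc_1)
  qed
qed

theorem proposition1p5:
  fixes q \<alpha> \<beta> x y :: complex and n :: nat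
  assumes "norm q < 1"
  shows "q_partial_x q (\<lambda>x y. Phi q n \<alpha> \<beta> x y - \<beta> * Phi q n \<alpha> \<beta> x (q * y)) x y
       = q_partial_y q (\<lambda>x y. Phi q n \<alpha> \<beta> x y - \<alpha> * Phi q n \<alpha> \<beta> (q * x) y) x y"
proof -
  have partial_x: "q_partial_x q (\<lambda>x y. Phi q n \<alpha> \<beta> x y - \<beta> * Phi q n \<alpha> \<beta> x (q * y)) x y
      = (1 - \<beta>) * ((1 - q ^ n) * (1 - \<alpha>) * Phi q (n - 1) (q * \<alpha>) (q * \<beta>) x y)"
    for \<alpha> \<beta> x y
    unfolding q_partial_x_def Phi_shift_y by (rule q_deriv_Phi[OF assms])
  have "q_partial_y q (\<lambda>x y. Phi q n \<alpha> \<beta> x y - \<alpha> * Phi q n \<alpha> \<beta> (q * x) y) x y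
      = q_partial_x q (\<lambda>y x. Phi q n \<beta> \<alpha> y x - \<alpha> * Phi q n \<beta> \<alpha> y (q * x)) y x"
    by (simp add: q_partial_x_def q_partial_y_def Phi_swap[of q n \<alpha> \<beta>])
  then show ?thesis
    unfolding partial_x Phi_swap[of q "n - 1" "q * \<alpha>" "q * \<beta>" x y] by (simp only: ac_simps)
qed

end
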